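(* Let $\delta\in\mathbb{C}$ and let $(N,\cdot,\circ)$ be a $\delta$-Novikov--Poisson algebra over $\mathbb{C}$. Define $[x,y]=x\circ y-y\circ x$ for $x,y\in N$. Then $(N,\cdot,[\cdot,\cdot])$ is a transposed $(\delta+1)$-Poisson algebra.
   Context: A (left) $\delta$-Novikov algebra is an algebra $(N,\circ)$ satisfying $\delta(x\circ y)\circ z-x\circ(y\circ z)=\delta(y\circ x)\circ z-y\circ(x\circ z)$ and $(x\circ y)\circ z=(x\circ z)\circ y$. A $\delta$-Novikov--Poisson algebra is a vector space $N$ with two bilinear operations $\cdot$ (also written by juxtaposition) and $\circ$ such that $(N,\cdot)$ is a commutative associative algebra, $(N,\circ)$ is a $\delta$-Novikov algebra, and for all $x,y,z\in N$: $(xy)\circ z=x(y\circ z)$ and $\delta(x\circ y)z-x\circ(yz)=\delta(y\circ x)z-y\circ(xz)$. For $\gamma\in\mathbb{C}$, a transposed $\gamma$-Poisson algebra is a triple $(P,\cdot,\{\cdot,\cdot\})$ such that $(P,\cdot)$ is a commutative associative algebra, $(P,\{\cdot,\cdot\})$ is a Lie algebra, and $\gamma\, x\{y,z\}=\{xy,z\}+\{y,xz\}$ for all $x,y,z\in P$. *)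

theory Defs
  imports Complex_Main
begin

text \<open>
  Algebras are nonassociative and nonunital unless stated otherwise: a complex vector space
  (the whole type \<^typ>\<open>'a\<close>) with a bilinear product.
\<close>

locale complex_algebra = vector_space scale
  for scale :: "complex \<Rightarrow> 'a::ab_group_add \<Rightarrow> 'a" (infixr \<open>*\<^sub>C\<close> 75) +
  fixes prod :: "'a \<Rightarrow> 'a \<Rightarrow> 'a"
  assumes linear_left: "Vector_Spaces.linear (*\<^sub>C) (*\<^sub>C) (\<lambda>x. prod x y)"
    and linear_right: "Vector_Spaces.linear (*\<^sub>C) (*\<^sub>C) (\<lambda>y. prod x y)"

locale comm_assoc_algebra = complex_algebra scale prod + abel_semigroup prod
  for scale :: "complex \<Rightarrow> 'a::ab_group_add \<Rightarrow> 'a" (infixr \<open>*\<^sub>C\<close> 75)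
    and prod :: "'a \<Rightarrow> 'a \<Rightarrow> 'a"

locale lie_algebra = complex_algebra scale bracket
  for scale :: "complex \<Rightarrow> 'a::ab_group_add \<Rightarrow> 'a" (infixr \<open>*\<^sub>C\<close> 75)
    and bracket :: "'a \<Rightarrow> 'a \<Rightarrow> 'a" +
  assumes alternating: "bracket x x = 0"
    and jacobi: "bracket x (bracket y z) + bracket y (bracket z x) + bracket z (bracket x y) = 0"

locale novikov_algebra = complex_algebra scale circ
  for scale :: "complex \<Rightarrow> 'a::ab_group_add \<Rightarrow> 'a" (infixr \<open>*\<^sub>C\<close> 75)
    and \<delta> :: complex
    and circ :: "'a \<Rightarrow> 'a \<Rightarrow> 'a" (infixl \<open>\<circ>\<^sub>N\<close> 70) +
  assumes left_symmetric:
      "\<delta> *\<^sub>C ((x \<circ>\<^sub>N y) \<circ>\<^sub>N z) - x \<circ>\<^sub>N (y \<circ>\<^sub>N z) = \<delta> *\<^sub>C ((y \<circ>\<^sub>N x) \<circ>\<^sub>N z) - y \<circ>\<^sub>N (x \<circ>\<^sub>N z)"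
    and right_commutative: "(x \<circ>\<^sub>N y) \<circ>\<^sub>N z = (x \<circ>\<^sub>N z) \<circ>\<^sub>N y"

locale novikov_poisson_algebra =
  comm_assoc_algebra scale dot + novikov_algebra scale \<delta> circ
  for scale :: "complex \<Rightarrow> 'a::ab_group_add \<Rightarrow> 'a" (infixr \<open>*\<^sub>C\<close> 75)
    and \<delta> :: complex
    and dot :: "'a \<Rightarrow> 'a \<Rightarrow> 'a" (infixl \<open>\<cdot>\<close> 70)
    and circ :: "'a \<Rightarrow> 'a \<Rightarrow> 'a" (infixl \<open>\<circ>\<^sub>N\<close> 70) +
  assumes dot_circ: "(x \<cdot> y) \<circ>\<^sub>N z = x \<cdot> (y \<circ>\<^sub>N z)"
    and circ_dot:
      "\<delta> *\<^sub>C ((x \<circ>\<^sub>N y) \<cdot> z) - x \<circ>\<^sub>N (y \<cdot> z) = \<delta> *\<^sub>C ((y \<circ>\<^sub>N x) \<cdot> z) - y \<circ>\<^sub>N (x \<cdot> z)"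

locale transposed_poisson_algebra =
  comm_assoc_algebra scale dot + lie_algebra scale bracket
  for scale :: "complex \<Rightarrow> 'a::ab_group_add \<Rightarrow> 'a" (infixr \<open>*\<^sub>C\<close> 75)
    and \<gamma> :: complex
    and dot :: "'a \<Rightarrow> 'a \<Rightarrow> 'a" (infixl \<open>\<cdot>\<close> 70)
    and bracket :: "'a \<Rightarrow> 'a \<Rightarrow> 'a" +
  assumes transposed_leibniz:
      "\<gamma> *\<^sub>C (x \<cdot> bracket y z) = bracket (x \<cdot> y) z + bracket y (x \<cdot> z)"

definition commutator :: "('a::ab_group_add \<Rightarrow> 'a \<Rightarrow> 'a) \<Rightarrow> 'a \<Rightarrow> 'a \<Rightarrow> 'a" where
  "commutator f x y = f x y - f y x"

end

theory Submission
  imports Defs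
begin

text \<open>
  Write \<open>[x, y]\<close> for the commutator of \<open>\<circ>\<close>. Left symmetry says
  \<open>x \<circ> (y \<circ> z) - y \<circ> (x \<circ> z) = \<delta> ([x, y] \<circ> z)\<close>. When the Jacobi sum is expanded, the terms
  bracketed to the right can be grouped, over the cyclic sum, into such differences, so it equals
  \<open>\<delta> - 1\<close> times the cyclic sum of \<open>[x, y] \<circ> z\<close>. The latter vanishes for every \<open>\<delta>\<close>: right
  commutativity turns \<open>(y \<circ> x) \<circ> z\<close> into \<open>(y \<circ> z) \<circ> x\<close>, a cyclic shift of \<open>(x \<circ> y) \<circ> z\<close>.

  The factor \<open>\<delta> + 1\<close> in the transposed Leibniz rule has two sources. In \<open>[xy, z] + [y, xz]\<close> the
  terms \<open>(xy) \<circ> z - (xz) \<circ> y\<close> give \<open>x [y, z]\<close> by \<open>(xy) \<circ> z = x (y \<circ> z)\<close>, and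
  the terms \<open>y \<circ> (xz) - z \<circ> (xy)\<close> give \<open>\<delta> x [y, z]\<close> by the other compatibility condition.
\<close>

lemma (in complex_algebra) prod_diff_left: "prod (x - y) z = prod x z - prod y z"
proof -
  interpret Vector_Spaces.linear scale scale "\<lambda>x. prod x z" by (rule linear_left)
  show ?thesis by (rule diff)
qed

lemma (in complex_algebra) prod_diff_right: "prod x (y - z) = prod x y - prod x z"
proof -
  interpret Vector_Spaces.linear scale scale "\<lambda>y. prod x y" by (rule linear_right)
  show ?thesis by (rule diff)
qed

lemma (in complex_algebra) commutator_complex_algebra: "complex_algebra scale (commutator prod)"
proof -
  interpret vector_space_pair scale scale ..
  show ?thesis
    unfolding complex_algebra_def complex_algebra_axioms_def commutator_def
    using vector_space_axioms linear_left linear_right by (simp add: linear_compose_sub)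
qed

context novikov_algebra
begin

lemma left_symmetric_commutator:
  "x \<circ>\<^sub>N (y \<circ>\<^sub>N z) - y \<circ>\<^sub>N (x \<circ>\<^sub>N z) = \<delta> *\<^sub>C (commutator circ x y \<circ>\<^sub>N z)"
  using left_symmetric[of x y z]
  by (simp add: commutator_def prod_diff_left scale_right_diff_distrib algebra_simps)

text \<open>
  The six terms cancel in pairs: each negative term, with its two right factors exchanged, is one of
  the positive ones.
\<close>
lemma cyclic_sum_commutator_circ:
  "commutator circ x y \<circ>\<^sub>N z + commutator circ y z \<circ>\<^sub>N x + commutator circ z x \<circ>\<^sub>N y = 0"
  using right_commutative[of y x z] right_commutative[of z y x] right_commutative[of x z y]
  by (simp add: commutator_def prod_diff_left)

text \<open>
  A term \<open>x \<circ> (z \<circ> y)\<close> has to be paired with \<open>z \<circ> (x \<circ> y)\<close>, which comes from a different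
  summand of the Jacobi sum, for left symmetry to apply.
\<close>
lemma commutator_jacobi:
  "commutator circ x (commutator circ y z) + commutator circ y (commutator circ z x)
    + commutator circ z (commutator circ x y) = 0"
proof -
  let ?S = "commutator circ x y \<circ>\<^sub>N z + commutator circ y z \<circ>\<^sub>N x + commutator circ z x \<circ>\<^sub>N y"
  have "commutator circ x (commutator circ y z) + commutator circ y (commutator circ z x)
      + commutator circ z (commutator circ x y)
    = (x \<circ>\<^sub>N (y \<circ>\<^sub>N z) - y \<circ>\<^sub>N (x \<circ>\<^sub>N z)) + (y \<circ>\<^sub>N (z \<circ>\<^sub>N x) - z \<circ>\<^sub>N (y \<circ>\<^sub>N x))
      + (z \<circ>\<^sub>N (x \<circ>\<^sub>N y) - x \<circ>\<^sub>N (z \<circ>\<^sub>N y)) - ?S"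
    by (simp add: commutator_def prod_diff_left prod_diff_right)
  also have "\<dots> = \<delta> *\<^sub>C ?S - ?S"
    by (simp only: left_symmetric_commutator scale_right_distrib)
  also have "\<dots> = 0"
    by (simp add: cyclic_sum_commutator_circ)
  finally show ?thesis .
qed

lemma commutator_lie_algebra: "lie_algebra scale (commutator circ)"
proof -
  interpret commutator: complex_algebra scale "commutator circ"
    by (rule commutator_complex_algebra)
  show ?thesis
    by unfold_locales (simp add: commutator_def, rule commutator_jacobi)
qed

end

lemma (in comm_assoc_algebra) prod_commutator_right:
  "prod x (commutator f y z) = prod x (f y z) - prod x (f z y)"
  by (simp add: commutator_def prod_diff_right)

lemma (in novikov_poisson_algebra) commutator_transposed_leibniz:
  "(\<delta> + 1) *\<^sub>C (x \<cdot> commutator circ y z) = commutator circ (x \<cdot> y) z + commutator circ y (x \<cdot> z)"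
proof -
  \<comment> \<open>The compatibility condition is used with \<open>x\<close> as the last argument, where it is the factor
    multiplied by the commutator of the other two.\<close>
  have "\<delta> *\<^sub>C (x \<cdot> commutator circ y z) = y \<circ>\<^sub>N (x \<cdot> z) - z \<circ>\<^sub>N (x \<cdot> y)"
    using circ_dot[of y z x]
    by (simp add: prod_commutator_right scale_right_diff_distrib commute algebra_simps)
  moreover have "x \<cdot> commutator circ y z = (x \<cdot> y) \<circ>\<^sub>N z - (x \<cdot> z) \<circ>\<^sub>N y"
    by (simp add: prod_commutator_right dot_circ)
  ultimately show ?thesis
    by (simp add: scale_left_distrib commutator_def)
qed

theorem theorem41:
  fixes \<delta> :: complex
    and scale :: "complex \<Rightarrow> 'a::ab_group_add \<Rightarrow> 'a"
    and dot circ :: "'a \<Rightarrow> 'a \<Rightarrow> 'a"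
  assumes "novikov_poisson_algebra scale \<delta> dot circ"
  shows "transposed_poisson_algebra scale (\<delta> + 1) dot (commutator circ)"
proof -
  interpret novikov_poisson_algebra scale \<delta> dot circ by fact
  interpret commutator: lie_algebra scale "commutator circ"
    by (rule commutator_lie_algebra)
  show ?thesis
    by unfold_locales (rule commutator_transposed_leibniz)
qed

end
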